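(* Let $A\in\mathbb{R}^{m\times n}$ be nonzero and $b\in\mathbb{R}^m$. Let $\mathcal{D}$ be a distribution of random matrix quadruples $(S_1,S_2,T_1,T_2)$ satisfying $\mathbb{E}[T_1T_2^\top A^\top S_1S_2^\top]=\frac{A^\top}{\|A\|_F^2}$. Let $x_{LS}^*=A^\dagger b$, let $x^0\in\mathbb{R}^n$ be an arbitrary (deterministic) initial vector, and let $\{x^k\}_{k=0}^\infty$ be generated by the PFR iteration $$x^{k+1}=x^{k}-\alpha T_1T_2^\top A^\top S_1S_2^\top(Ax^{k}-b),\qquad k\ge 0,$$ where at each iteration a fresh quadruple $(S_1,S_2,T_1,T_2)$ is drawn independently from $\mathcal{D}$. Denote $r^*=Ax_{LS}^*-b$ and $r^k=Ax^k-b$, and let $$\beta=\big\|\mathbb{E}[ S_2S_1^\top AT_2T_1^\top A^\top A T_1T_2^\top A^\top S_1S_2^\top ]\big\|_2,\qquad \eta=1-2\alpha\frac{\sigma_{\min}^2(A)}{\|A\|^2_F}+2\alpha^2\beta .$$ If $0<\alpha<\frac{\sigma^2_{\min}(A)}{\beta\|A\|^2_F}$, then for every $k\ge 0$ $$\mathbb{E}\big[\|r^k-r^*\|^2_2\big]\leq\eta^k \|r^0-r^*\|^2_2+\frac{2\alpha^2\beta(1-\eta^k)\|r^*\|^2_2}{1-\eta}.$$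
   Context: $A^\dagger$ is the Moore-Penrose pseudoinverse; $\|\cdot\|_F$ is the Frobenius norm; $\|\cdot\|_2$ is the Euclidean norm of a vector or the spectral norm of a matrix; $\sigma_{\min}(A)$ is the smallest nonzero singular value of $A$. The linear system $Ax=b$ may be consistent or inconsistent and $A$ may have any rank. The random matrices have sizes $S_1,S_2\in\mathbb{R}^{m\times p}$ and $T_1,T_2\in\mathbb{R}^{n\times s}$, where $p,s$ may themselves be random; the four matrices in a quadruple need not be independent of each other, but quadruples used at different iterations are independent and identically distributed. All expectations appearing are assumed to exist and be finite. *)

theory Defs
  imports "HOL-Probability.Probability"
begin

text \<open>
  Matrices with row index type \<open>'m\<close> and a (possibly random) number of columns are encoded as the
  list of their columns, so that the length of the list is the number of columns.
  The \<open>\<sigma>\<close>-algebra is the Borel \<open>\<sigma>\<close>-algebra of the disjoint union over all \<open>p\<close> of the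
  spaces of matrices with \<open>p\<close> columns, obtained from the injection that sends a matrix to its
  number of columns and its zero-padded sequence of columns.
\<close>

definition column_list_algebra :: "(real ^ 'm) list measure" where
  "column_list_algebra =
     vimage_algebra UNIV
       (\<lambda>S. (length S, \<lambda>j. if j < length S then S ! j else 0))
       (count_space (UNIV :: nat set) \<Otimes>\<^sub>M (\<Pi>\<^sub>M j\<in>(UNIV :: nat set). borel))"

text \<open>
  The space of quadruples \<open>(S\<^sub>1, S\<^sub>2, T\<^sub>1, T\<^sub>2)\<close> in which \<open>S\<^sub>1, S\<^sub>2\<close> have a common number of
  columns (\<open>p\<close>) and \<open>T\<^sub>1, T\<^sub>2\<close> have a common number of columns (\<open>s\<close>).
\<close>

definition quadruple_algebra ::
  "((real ^ 'm) list \<times> (real ^ 'm) list \<times> (real ^ 'n) list \<times> (real ^ 'n) list) measure" where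
  "quadruple_algebra =
     restrict_space
       (column_list_algebra \<Otimes>\<^sub>M column_list_algebra \<Otimes>\<^sub>M column_list_algebra \<Otimes>\<^sub>M column_list_algebra)
       {(S\<^sub>1, S\<^sub>2, T\<^sub>1, T\<^sub>2). length S\<^sub>1 = length S\<^sub>2 \<and> length T\<^sub>1 = length T\<^sub>2}"

text \<open>
  The product of \<open>S\<close> with the transpose of \<open>S'\<close>; only meant for arguments with the same number
  of columns.
\<close>

definition mult_transpose :: "(real ^ 'm) list \<Rightarrow> (real ^ 'm) list \<Rightarrow> real ^ 'm ^ 'm" where
  "mult_transpose S S' = (\<chi> i j. \<Sum>l<length S. (S ! l) $ i * (S' ! l) $ j)"

definition is_pseudoinverse :: "real ^ 'n ^ 'm \<Rightarrow> real ^ 'm ^ 'n \<Rightarrow> bool" where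
  "is_pseudoinverse A X \<longleftrightarrow>
     A ** X ** A = A \<and> X ** A ** X = X \<and>
     transpose (A ** X) = A ** X \<and> transpose (X ** A) = X ** A"

definition pseudoinverse :: "real ^ 'n ^ 'm \<Rightarrow> real ^ 'm ^ 'n" where
  "pseudoinverse A = (THE X. is_pseudoinverse A X)"

definition singular_values :: "real ^ 'n ^ 'm \<Rightarrow> real set" where
  "singular_values A =
     {sqrt \<mu> | \<mu>. \<exists>v. v \<noteq> 0 \<and> (transpose A ** A) *v v = \<mu> *\<^sub>R v}"

definition sigma_min :: "real ^ 'n ^ 'm \<Rightarrow> real" where
  "sigma_min A = Min (singular_values A - {0})"

definition spectral_norm :: "real ^ 'n ^ 'm \<Rightarrow> real" where
  "spectral_norm A = onorm (\<lambda>v. A *v v)"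

definition frobenius_norm :: "real ^ 'n ^ 'm \<Rightarrow> real" where
  "frobenius_norm A = sqrt (\<Sum>i\<in>UNIV. \<Sum>j\<in>UNIV. (A $ i $ j)\<^sup>2)"

lemma frobenius_norm_eq_norm: "frobenius_norm A = norm A"
  by (simp add: frobenius_norm_def norm_vec_def L2_set_def sum_nonneg)

end

theory Submission
  imports Defs
begin

text \<open>
  Write \<open>W = T\<^sub>1 T\<^sub>2\<^sup>T A\<^sup>T S\<^sub>1 S\<^sub>2\<^sup>T\<close> and \<open>e\<^sup>k = r\<^sup>k - r\<^sup>*\<close>, so that
  \<open>e\<^sup>k\<^sup>+\<^sup>1 = e\<^sup>k - \<alpha> A W r\<^sup>k\<close>. Conditionally on the past, the cross term of
  \<open>\<parallel>e\<^sup>k\<^sup>+\<^sup>1\<parallel>\<^sup>2\<close> has mean \<open>-2 \<alpha> \<parallel>A\<^sup>T e\<^sup>k\<parallel>\<^sup>2 / \<parallel>A\<parallel>\<^sub>F\<^sup>2\<close>, because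
  \<open>A\<^sup>T r\<^sup>* = 0\<close>, and \<open>e\<^sup>k\<close> lies in the range of \<open>A\<close>, where \<open>\<parallel>A\<^sup>T e\<parallel> \<ge> \<sigma>\<^sub>m\<^sub>i\<^sub>n \<parallel>e\<parallel>\<close>.
  The quadratic term is at most \<open>\<alpha>\<^sup>2 \<beta> \<parallel>r\<^sup>k\<parallel>\<^sup>2 \<le> 2 \<alpha>\<^sup>2 \<beta> (\<parallel>e\<^sup>k\<parallel>\<^sup>2 + \<parallel>r\<^sup>*\<parallel>\<^sup>2)\<close>.
  This gives the recurrence \<open>E\<parallel>e\<^sup>k\<^sup>+\<^sup>1\<parallel>\<^sup>2 \<le> \<eta> E\<parallel>e\<^sup>k\<parallel>\<^sup>2 + 2 \<alpha>\<^sup>2 \<beta> \<parallel>r\<^sup>*\<parallel>\<^sup>2\<close>,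
  which unrolls because \<open>0 \<le> \<eta> < 1\<close>.
\<close>

section \<open>Adjoints and kernels of real matrices\<close>

declare transpose_matrix_vector [simp del]

lemma inner_matrix_transpose:
  fixes A :: "real ^ 'n ^ 'm"
  shows "x \<bullet> (A *v y) = (transpose A *v x) \<bullet> y"
  by (simp add: dot_lmul_matrix transpose_matrix_vector)

lemma norm_matrix_vector_sq:
  fixes A :: "real ^ 'n ^ 'm"
  shows "(norm (A *v y))\<^sup>2 = y \<bullet> ((transpose A ** A) *v y)"
  by (metis inner_matrix_transpose inner_commute matrix_vector_mul_assoc power2_norm_eq_inner)

lemma transpose_mult_self_eq_0:
  fixes A :: "real ^ 'n ^ 'm"
  assumes "transpose A *v (A *v y) = 0"
  shows "A *v y = 0"
  by (metis assms inner_eq_zero_iff inner_matrix_transpose inner_zero_left)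

section \<open>Existence and uniqueness of the Moore-Penrose pseudoinverse\<close>

text \<open>A X and A Y are both the orthogonal projection onto the range of A, hence equal;
  likewise X A = Y A is the projection onto the range of A^T. Then X = X A X = Y A X = Y A Y =
  Y.\<close>

lemma is_pseudoinverse_unique:
  assumes "is_pseudoinverse A X" "is_pseudoinverse A Y"
  shows "X = Y"
proof -
  note X = assms(1)[unfolded is_pseudoinverse_def] and Y = assms(2)[unfolded is_pseudoinverse_def]
  have "A ** X = transpose ((A ** Y ** A) ** X)" using X Y by simp
  also have "\<dots> = transpose (A ** X) ** transpose (A ** Y)"
    by (simp only: matrix_transpose_mul matrix_mul_assoc)
  also have "\<dots> = (A ** X ** A) ** Y" using X Y by (simp add: matrix_mul_assoc)
  finally have 1: "A ** X = A ** Y" using X by simp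
  have "X ** A = transpose (X ** (A ** Y ** A))" using X Y by simp
  also have "\<dots> = transpose (Y ** A) ** transpose (X ** A)"
    by (simp only: matrix_transpose_mul matrix_mul_assoc)
  also have "\<dots> = (Y ** A) ** (X ** A)" using X Y by simp
  also have "\<dots> = Y ** (A ** X ** A)" by (simp only: matrix_mul_assoc)
  finally have 2: "X ** A = Y ** A" using X by simp
  have "X = X ** A ** X" using X by simp
  also have "\<dots> = Y ** (A ** X)" by (simp only: 2 matrix_mul_assoc)
  also have "\<dots> = Y" using Y by (simp only: 1 matrix_mul_assoc)
  finally show ?thesis .
qed

text \<open>On S, the range of A^T, the map A^T A is an injective endomorphism, hence bijective by
  dimension. With \<open>g\<close> inverting it on S, X = g A^T sends y to the solution in S of the
  normal equations, that is, to the least-squares solution of minimal norm.\<close>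

lemma is_pseudoinverse_exists:
  fixes A :: "real ^ 'n ^ 'm"
  shows "\<exists>X. is_pseudoinverse A X"
proof -
  define S where "S = range ((*v) (transpose A))"
  define f where "f = (\<lambda>v. transpose A *v (A *v v))"
  have lf: "linear f"
    unfolding f_def matrix_vector_mul_assoc by (rule matrix_vector_mul_linear)
  have sS: "subspace S" unfolding S_def
    by (intro linear_subspace_image subspace_UNIV matrix_vector_mul_linear)
  have fS: "f v \<in> S" for v by (auto simp: f_def S_def)
  have S0: "v = 0" if v: "v \<in> S" "A *v v = 0" for v
  proof -
    obtain w where "v = transpose A *v w" using v(1) unfolding S_def by blast
    then have "v \<bullet> v = w \<bullet> (A *v v)" by (metis inner_matrix_transpose)
    then show ?thesis using v(2) by simp
  qed
  have f0: "v = 0" if "v \<in> S" "f v = 0" for v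
    using that S0 transpose_mult_self_eq_0 by (auto simp: f_def)
  have inj: "inj_on f S"
    using linear_injective_on_subspace_0[OF lf sS] f0 by auto
  have "f ` S = S"
  proof (rule subspace_dim_equal)
    have "span S = S" using sS span_eq_iff by blast
    then have "dim (f ` S) = dim S" using dim_image_eq[OF lf, of S] inj by presburger
    then show "dim S \<le> dim (f ` S)" by simp
    show "subspace (f ` S)" by (rule linear_subspace_image[OF lf sS])
    show "f ` S \<subseteq> S" using fS by blast
    show "subspace S" by (rule sS)
  qed
  obtain g where g: "range g \<subseteq> S" "linear g" "\<And>v. v \<in> S \<Longrightarrow> g (f v) = v"
    using linear_exists_left_inverse_on[OF lf sS inj] by blast
  define X where "X = matrix g ** transpose A"
  have gm: "matrix g *v v = g v" for v using g(2) by (simp add: matrix_works)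
  have Xv: "X *v y = g (transpose A *v y)" for y
    by (simp add: X_def gm flip: matrix_vector_mul_assoc)
  have XS: "X *v y \<in> S" for y using g(1) Xv by auto
  have normal: "transpose A *v (A *v (X *v y)) = transpose A *v y" for y
  proof -
    have "transpose A *v y \<in> f ` S" using \<open>f ` S = S\<close> by (auto simp: S_def)
    then obtain v where v: "v \<in> S" "transpose A *v y = f v" by blast
    then have "f (X *v y) = f v" using g(3) by (simp add: Xv)
    then show ?thesis using v(2) by (simp add: f_def)
  qed
  \<comment> \<open>Multiplying by X^T gives (A X)^T (A X) = (A X)^T; the left side is symmetric, so
    A X is too.\<close>
  have "transpose A ** (A ** X) = transpose A"
    unfolding matrix_eq by (simp only: normal matrix_vector_mul_assoc[symmetric] simp_thms)
  then have "transpose X ** (transpose A ** (A ** X)) = transpose X ** transpose A" by simp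
  then have "transpose (A ** X) ** (A ** X) = transpose (A ** X)"
    by (simp only: matrix_transpose_mul matrix_mul_assoc)
  then have "transpose (transpose (A ** X) ** (A ** X)) = A ** X" by simp
  then have 1: "transpose (A ** X) = A ** X"
    using \<open>transpose (A ** X) ** (A ** X) = transpose (A ** X)\<close>
    by (simp only: matrix_transpose_mul transpose_transpose)
  have ker: "A *v (X *v (A *v u) - u) = 0" for u
    by (rule transpose_mult_self_eq_0) (simp add: normal matrix_vector_mult_diff_distrib)
  then have 2: "A ** X ** A = A"
    by (simp add: matrix_eq matrix_vector_mult_diff_distrib flip: matrix_vector_mul_assoc)
  have "X *v (A *v (X *v y)) - X *v y = 0" for y
    using S0[OF subspace_diff[OF sS XS XS] ker] .
  then have 3: "X ** A ** X = X"
    by (simp add: matrix_eq flip: matrix_vector_mul_assoc)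
  \<comment> \<open>X A u - u lies in the kernel of A, which is orthogonal to S, while X A w lies in
    S. The right-hand side is symmetric in u and w, so X A is self-adjoint.\<close>
  have sym: "u \<bullet> (X *v (A *v w)) = (X *v (A *v u)) \<bullet> (X *v (A *v w))" for u w
  proof -
    obtain z where z: "X *v (A *v w) = transpose A *v z" using XS unfolding S_def by blast
    have "(X *v (A *v u) - u) \<bullet> (X *v (A *v w)) = z \<bullet> (A *v (X *v (A *v u) - u))"
      by (simp only: z inner_matrix_transpose[of z A] inner_commute)
    then show ?thesis by (simp add: ker inner_diff_left)
  qed
  have "w \<bullet> (transpose (X ** A) *v u) = w \<bullet> ((X ** A) *v u)" for u w
  proof -
    have "w \<bullet> (transpose (X ** A) *v u) = ((X ** A) *v w) \<bullet> u"
      using inner_matrix_transpose[of w "transpose (X ** A)" u] by (simp only: transpose_transpose)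
    then show ?thesis using sym[of u w] sym[of w u]
      by (simp only: inner_commute matrix_vector_mul_assoc)
  qed
  then have "transpose (X ** A) *v u = (X ** A) *v u" for u
    using vector_eq_ldot[of "transpose (X ** A) *v u"] by blast
  then have 4: "transpose (X ** A) = X ** A" unfolding matrix_eq by blast
  show ?thesis using 1 2 3 4 by (auto simp: is_pseudoinverse_def)
qed

lemma is_pseudoinverse_pseudoinverse: "is_pseudoinverse A (pseudoinverse A)"
  unfolding pseudoinverse_def
  by (rule theI') (use is_pseudoinverse_exists is_pseudoinverse_unique in blast)

text \<open>With X the pseudoinverse, symmetry of A X gives A^T A X = (A X A)^T = A^T.\<close>

lemma transpose_mult_residual:
  "transpose A *v (A *v (pseudoinverse A *v b) - b) = 0"
proof -
  let ?X = "pseudoinverse A"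
  have "transpose A ** (A ** ?X) = transpose A ** transpose (A ** ?X)"
    using is_pseudoinverse_pseudoinverse[of A] by (simp add: is_pseudoinverse_def)
  also have "\<dots> = transpose (A ** ?X ** A)" by (simp add: matrix_transpose_mul)
  also have "\<dots> = transpose A"
    using is_pseudoinverse_pseudoinverse[of A] by (simp add: is_pseudoinverse_def)
  finally show ?thesis
    by (simp add: matrix_vector_mult_diff_distrib matrix_vector_mul_assoc matrix_mul_assoc)
qed

section \<open>The smallest nonzero singular value\<close>

text \<open>Eigenvectors for distinct eigenvalues are orthogonal, so choosing one per eigenvalue
  gives an independent set. This makes the \<open>Min\<close> in \<open>sigma_min\<close> a minimum
  over a finite set.\<close>

lemma finite_eigenvalues_symmetric:
  fixes B :: "real ^ 'n ^ 'n"
  assumes "transpose B = B"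
  shows "finite {\<mu>. \<exists>v. v \<noteq> 0 \<and> B *v v = \<mu> *\<^sub>R v}"
proof -
  define E where "E = {\<mu>. \<exists>v. v \<noteq> 0 \<and> B *v v = \<mu> *\<^sub>R v}"
  define ev where "ev = (\<lambda>\<mu>. SOME v. v \<noteq> 0 \<and> B *v v = \<mu> *\<^sub>R v)"
  have ev: "ev \<mu> \<noteq> 0 \<and> B *v ev \<mu> = \<mu> *\<^sub>R ev \<mu>" if "\<mu> \<in> E" for \<mu>
    unfolding ev_def using that unfolding E_def mem_Collect_eq by (rule someI_ex)
  have orth: "ev \<mu> \<bullet> ev \<nu> = 0" if "\<mu> \<in> E" "\<nu> \<in> E" "\<mu> \<noteq> \<nu>" for \<mu> \<nu>
    using ev that inner_matrix_transpose[of "ev \<mu>" B "ev \<nu>"] assms by simp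
  have "inj_on ev E"
  proof (rule inj_onI, rule ccontr)
    fix \<mu> \<nu> assume *: "\<mu> \<in> E" "\<nu> \<in> E" "ev \<mu> = ev \<nu>" "\<mu> \<noteq> \<nu>"
    then have "ev \<nu> \<bullet> ev \<nu> = 0" using orth[OF *(1,2,4)] by simp
    then show False using ev *(2) by simp
  qed
  moreover have "finite (ev ` E)"
  proof (rule independent_imp_finite, rule pairwise_orthogonal_independent)
    show "pairwise orthogonal (ev ` E)"
      using orth unfolding pairwise_def orthogonal_def by blast
    show "0 \<notin> ev ` E" using ev by auto
  qed
  ultimately show ?thesis unfolding E_def[symmetric] by (metis finite_imageD)
qed

text \<open>Real \<open>sqrt\<close> is negative at negative arguments, so this is what makes
  singular values, and with them \<open>sigma_min\<close>, nonnegative; squaring an upper bound on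
  \<open>sigma_min\<close> relies on it.\<close>

lemma eigenvalue_transpose_mult_nonneg:
  fixes A :: "real ^ 'n ^ 'm"
  assumes "v \<noteq> 0" "(transpose A ** A) *v v = \<mu> *\<^sub>R v"
  shows "\<mu> \<ge> 0"
proof -
  have "(norm (A *v v))\<^sup>2 = \<mu> * (norm v)\<^sup>2"
    by (simp add: norm_matrix_vector_sq assms(2) flip: power2_norm_eq_inner)
  then have "0 \<le> \<mu> * (norm v)\<^sup>2" by (metis zero_le_power2)
  then show ?thesis using assms(1) by (simp add: zero_le_mult_iff)
qed

text \<open>First-order condition for a minimum at t = 0. If a were nonzero, t = -s a would give s
  a^2 (s c - 2), which is negative once s > 0 and s c <= 1.\<close>

lemma linear_coeff_zero_of_nonneg:
  fixes a c :: real
  assumes "\<And>t. 2 * t * a + t\<^sup>2 * c \<ge> 0"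
  shows "a = 0"
proof (rule ccontr)
  assume "a \<noteq> 0"
  define s where "s = 1 / (\<bar>c\<bar> + 1)"
  have s: "s > 0" "s * c \<le> 1" by (auto simp: s_def divide_simps)
  have "2 * (- s * a) * a + (- s * a)\<^sup>2 * c = s * a\<^sup>2 * (s * c - 2)"
    by (simp add: power2_eq_square algebra_simps)
  also have "\<dots> < 0" using s \<open>a \<noteq> 0\<close> by (intro mult_pos_neg mult_pos_pos) auto
  finally show False using assms[of "- s * a"] by linarith
qed

text \<open>
  The minimum \<open>\<mu>\<close> of \<open>\<parallel>A\<^sup>T v\<parallel>\<^sup>2\<close> over the unit sphere of the range of \<open>A\<close> is attained at an
  eigenvector \<open>v\<close> of \<open>A A\<^sup>T\<close>, and then \<open>A\<^sup>T v\<close> is an eigenvector of \<open>A\<^sup>T A\<close> with eigenvalue \<open>\<mu> > 0\<close>.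
\<close>

lemma sigma_min_le:
  fixes A :: "real ^ 'n ^ 'm"
  assumes "A \<noteq> 0"
  shows "(sigma_min A)\<^sup>2 * (norm (A *v u))\<^sup>2 \<le> (norm (transpose A *v (A *v u)))\<^sup>2"
proof -
  define V where "V = range ((*v) A)"
  define q where "q = (\<lambda>v. (norm (transpose A *v v))\<^sup>2)"
  have sV: "subspace V" unfolding V_def
    by (intro linear_subspace_image subspace_UNIV matrix_vector_mul_linear)
  obtain u0 where u0: "A *v u0 \<noteq> 0" using assms by (metis matrix_eq matrix_vector_mult_0)
  have "compact (V \<inter> sphere 0 1)" using sV by (simp add: closed_subspace closed_Int_compact)
  moreover have "V \<inter> sphere 0 1 \<noteq> {}"
  proof -
    have "(1 / norm (A *v u0)) *\<^sub>R (A *v u0) \<in> V \<inter> sphere 0 1"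
      using u0 sV by (auto simp: V_def intro!: subspace_scale)
    then show ?thesis by blast
  qed
  moreover have "continuous_on (V \<inter> sphere 0 1) q"
    unfolding q_def by (intro continuous_intros linear_continuous_on matrix_vector_mul_bounded_linear)
  ultimately have "\<exists>v\<in>V \<inter> sphere 0 1. \<forall>w\<in>V \<inter> sphere 0 1. q v \<le> q w"
    by (rule continuous_attains_inf)
  then obtain v where v: "v \<in> V" "norm v = 1"
    and min: "\<And>w. w \<in> V \<Longrightarrow> norm w = 1 \<Longrightarrow> q v \<le> q w"
    by auto
  define \<mu> where "\<mu> = q v"
  \<comment> \<open>Homogeneity extends the minimum from the unit sphere to all of V.\<close>
  have scal: "\<mu> * (norm w)\<^sup>2 \<le> q w" if "w \<in> V" for w
  proof (cases "w = 0")
    case False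
    have "\<mu> \<le> q ((1 / norm w) *\<^sub>R w)"
      unfolding \<mu>_def using that sV False by (intro min subspace_scale) auto
    also have "\<dots> = q w / (norm w)\<^sup>2"
      by (simp add: q_def matrix_vector_mult_scaleR power_divide)
    finally show ?thesis using False by (simp add: field_simps)
  qed (simp add: q_def)
  have q_eq: "q w = w \<bullet> (A *v (transpose A *v w))" for w
    by (metis q_def norm_matrix_vector_sq transpose_transpose matrix_vector_mul_assoc)
  \<comment> \<open>The defect of the eigenvalue equation, used as the direction of variation: it
    stays in V, so q(v + t z) - \<mu> |v + t z|^2 is nonnegative for all t. This expression vanishes
    at t = 0 and has linear coefficient 2 (z, z), which forces z = 0.\<close>
  define z where "z = A *v (transpose A *v v) - \<mu> *\<^sub>R v"
  have zV: "z \<in> V" unfolding z_def using v(1) sV by (intro subspace_diff subspace_scale) (auto simp: V_def)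
  have "z \<bullet> z = 0"
  proof (rule linear_coeff_zero_of_nonneg)
    fix t
    have "0 \<le> q (v + t *\<^sub>R z) - \<mu> * (norm (v + t *\<^sub>R z))\<^sup>2"
      using scal[of "v + t *\<^sub>R z"] v(1) zV sV by (simp add: subspace_add subspace_scale)
    also have "q (v + t *\<^sub>R z) = q v + 2 * t * (z \<bullet> (A *v (transpose A *v v))) + t\<^sup>2 * q z"
    proof -
      have "v \<bullet> (A *v (transpose A *v z)) = z \<bullet> (A *v (transpose A *v v))"
        by (metis inner_matrix_transpose inner_commute transpose_transpose)
      then show ?thesis
        by (simp add: q_eq matrix_vector_right_distrib matrix_vector_mult_scaleR algebra_simps
            inner_add_left inner_add_right power2_eq_square)
    qed
    also have "(norm (v + t *\<^sub>R z))\<^sup>2 = (norm v)\<^sup>2 + 2 * t * (z \<bullet> v) + t\<^sup>2 * (norm z)\<^sup>2"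
      unfolding power2_norm_eq_inner
      by (simp add: inner_add_left inner_add_right algebra_simps inner_commute power2_eq_square)
    also have "q v + 2 * t * (z \<bullet> (A *v (transpose A *v v))) + t\<^sup>2 * q z
        - \<mu> * ((norm v)\<^sup>2 + 2 * t * (z \<bullet> v) + t\<^sup>2 * (norm z)\<^sup>2)
      = 2 * t * (z \<bullet> z) + t\<^sup>2 * (q z - \<mu> * (norm z)\<^sup>2)"
    proof -
      have "z \<bullet> z = z \<bullet> (A *v (transpose A *v v)) - \<mu> * (z \<bullet> v)"
        unfolding z_def by (simp only: inner_diff_right inner_scaleR_right)
      then have "z \<bullet> (A *v (transpose A *v v)) = z \<bullet> z + \<mu> * (z \<bullet> v)" by simp
      then show ?thesis using v(2) by (simp add: \<mu>_def algebra_simps)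
    qed
    finally show "0 \<le> 2 * t * (z \<bullet> z) + t\<^sup>2 * (q z - \<mu> * (norm z)\<^sup>2)" .
  qed
  then have eig: "A *v (transpose A *v v) = \<mu> *\<^sub>R v" by (simp add: z_def)
  \<comment> \<open>The kernel of A^T meets the range of A only in 0. Hence \<mu> > 0, and its root
    survives the removal of 0 from the singular values.\<close>
  have nz: "transpose A *v v \<noteq> 0"
    using v transpose_mult_self_eq_0[of A] by (force simp: V_def)
  then have "\<mu> > 0" by (simp add: \<mu>_def q_def)
  have eig': "(transpose A ** A) *v (transpose A *v v) = \<mu> *\<^sub>R (transpose A *v v)"
    using eig by (simp add: matrix_vector_mult_scaleR flip: matrix_vector_mul_assoc)
  have "singular_values A = sqrt ` {\<mu>. \<exists>v. v \<noteq> 0 \<and> (transpose A ** A) *v v = \<mu> *\<^sub>R v}"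
    by (auto simp: singular_values_def)
  then have fin: "finite (singular_values A - {0})"
    using finite_eigenvalues_symmetric[of "transpose A ** A"]
    by (simp add: matrix_transpose_mul)
  have mem: "sqrt \<mu> \<in> singular_values A - {0}"
    using nz eig' \<open>\<mu> > 0\<close> by (auto simp: singular_values_def)
  have "sigma_min A \<in> singular_values A"
    unfolding sigma_min_def using Min_in[OF fin] mem by blast
  then have "0 \<le> sigma_min A"
    using eigenvalue_transpose_mult_nonneg[of _ A] by (auto simp: singular_values_def)
  moreover have "sigma_min A \<le> sqrt \<mu>"
    unfolding sigma_min_def using fin mem by (rule Min_le)
  ultimately have "(sigma_min A)\<^sup>2 \<le> \<mu>"
    using \<open>\<mu> > 0\<close> by (metis power_mono real_sqrt_pow2 less_imp_le)
  then have "(sigma_min A)\<^sup>2 * (norm (A *v u))\<^sup>2 \<le> \<mu> * (norm (A *v u))\<^sup>2"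
    by (intro mult_right_mono) auto
  also have "\<dots> \<le> q (A *v u)" by (rule scal) (simp add: V_def)
  finally show ?thesis by (simp add: q_def)
qed

section \<open>Expectations under independence and the expected effect of one step\<close>

text \<open>Takes the place of conditioning on X: independence makes the joint law a product, and
  Tonelli integrates out Y with the value of X frozen.\<close>

lemma (in prob_space) indep_var_nn_integral_le:
  assumes "indep_var S X T Y" and "(\<lambda>(x, y). g x y) \<in> borel_measurable (S \<Otimes>\<^sub>M T)"
    and le: "\<And>x. x \<in> space S \<Longrightarrow> (\<integral>\<^sup>+ \<omega>. g x (Y \<omega>) \<partial>M) \<le> h x"
    and "h \<in> borel_measurable S"
  shows "(\<integral>\<^sup>+ \<omega>. g (X \<omega>) (Y \<omega>) \<partial>M) \<le> (\<integral>\<^sup>+ \<omega>. h (X \<omega>) \<partial>M)"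
proof -
  note ind = assms(1)[unfolded indep_var_distribution_eq]
  then have [measurable]: "X \<in> measurable M S" "Y \<in> measurable M T" by auto
  note [measurable] = assms(2,4)
  interpret Y: prob_space "distr M T Y" by (rule prob_space_distr) measurable
  have "(\<integral>\<^sup>+ \<omega>. g (X \<omega>) (Y \<omega>) \<partial>M)
      = (\<integral>\<^sup>+ (x, y). g x y \<partial>distr M (S \<Otimes>\<^sub>M T) (\<lambda>\<omega>. (X \<omega>, Y \<omega>)))"
    by (simp add: nn_integral_distr)
  also have "\<dots> = (\<integral>\<^sup>+ (x, y). g x y \<partial>(distr M S X \<Otimes>\<^sub>M distr M T Y))" using ind by simp
  also have "\<dots> = (\<integral>\<^sup>+ x. \<integral>\<^sup>+ y. g x y \<partial>distr M T Y \<partial>distr M S X)"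
  proof -
    have "sets (distr M S X \<Otimes>\<^sub>M distr M T Y) = sets (S \<Otimes>\<^sub>M T)"
      by (intro sets_pair_measure_cong sets_distr)
    then have "(\<lambda>(x, y). g x y) \<in> borel_measurable (distr M S X \<Otimes>\<^sub>M distr M T Y)"
      using assms(2) by (simp cong: measurable_cong_sets)
    from Y.nn_integral_fst[OF this] show ?thesis by simp
  qed
  also have "\<dots> \<le> (\<integral>\<^sup>+ x. h x \<partial>distr M S X)"
    by (rule nn_integral_mono) (simp add: nn_integral_distr le)
  also have "\<dots> = (\<integral>\<^sup>+ \<omega>. h (X \<omega>) \<partial>M)" by (simp add: nn_integral_distr)
  finally show ?thesis .
qed

text \<open>Equal lengths matter because \<open>mult_transpose\<close> sums over the length of its
  first argument.\<close>

lemma transpose_mult_transpose: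
  "length S = length S' \<Longrightarrow> transpose (mult_transpose S S') = mult_transpose S' S"
  by (simp add: mult_transpose_def transpose_def vec_eq_iff mult.commute)

lemma inner_le_spectral_norm:
  fixes B :: "real ^ 'n ^ 'n"
  shows "v \<bullet> (B *v v) \<le> spectral_norm B * (norm v)\<^sup>2"
proof -
  have "v \<bullet> (B *v v) \<le> norm v * norm (B *v v)" by (rule norm_cauchy_schwarz)
  also have "\<dots> \<le> norm v * (spectral_norm B * norm v)"
    unfolding spectral_norm_def
    by (intro mult_left_mono onorm matrix_vector_mul_bounded_linear) auto
  finally show ?thesis by (simp add: power2_eq_square algebra_simps)
qed

lemma spectral_norm_nonneg: "0 \<le> spectral_norm B" for B :: "real ^ 'n ^ 'm"
  unfolding spectral_norm_def by (rule onorm_pos_le) simp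

text \<open>Lets the expectation of a random matrix be taken inside a bilinear form with fixed
  vectors.\<close>

lemma bounded_linear_matrix_form:
  fixes v :: "real ^ 'm" and w :: "real ^ 'n"
  shows "bounded_linear (\<lambda>B :: real ^ 'n ^ 'm. v \<bullet> (B *v w))"
  unfolding linear_conv_bounded_linear[symmetric]
  by (rule linearI)
    (simp_all add: matrix_vector_mult_add_rdistrib inner_add_right scaleR_matrix_vector_assoc[symmetric])

text \<open>Expanding the square leaves a cross term linear in W and a quadratic term linear in W^T
  A^T A W, so both expectations move onto the matrices. The mean of W then gives the inner product,
  and the spectral norm bounds the quadratic form.\<close>

lemma (in prob_space)
  fixes A :: "real ^ 'n ^ 'm" and W :: "'a \<Rightarrow> real ^ 'm ^ 'n"
  assumes W: "integrable M W"
    and G: "integrable M (\<lambda>q. transpose (W q) ** transpose A ** A ** W q)"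
    and EW: "expectation W = c *\<^sub>R transpose A"
  shows integrable_norm_step_sq:
      "integrable M (\<lambda>q. (norm (e - \<alpha> *\<^sub>R (A *v (W q *v v))))\<^sup>2)"
    and expectation_norm_step_sq_le:
      "expectation (\<lambda>q. (norm (e - \<alpha> *\<^sub>R (A *v (W q *v v))))\<^sup>2)
       \<le> (norm e)\<^sup>2 - 2 * \<alpha> * c * ((transpose A *v e) \<bullet> (transpose A *v v))
         + \<alpha>\<^sup>2 * spectral_norm (expectation (\<lambda>q. transpose (W q) ** transpose A ** A ** W q))
           * (norm v)\<^sup>2"
proof -
  let ?G = "\<lambda>q. transpose (W q) ** transpose A ** A ** W q"
  let ?l = "\<lambda>B. (transpose A *v e) \<bullet> (B *v v)" and ?b = "\<lambda>B. v \<bullet> (B *v v)"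
  have expand: "(norm (e - \<alpha> *\<^sub>R (A *v (W q *v v))))\<^sup>2
      = (norm e)\<^sup>2 - 2 * \<alpha> * ?l (W q) + \<alpha>\<^sup>2 * ?b (?G q)" for q
  proof -
    have "?b (?G q) = (norm (A *v (W q *v v)))\<^sup>2"
      by (metis matrix_mul_assoc matrix_transpose_mul matrix_vector_mul_assoc norm_matrix_vector_sq)
    moreover have "?l (W q) = e \<bullet> (A *v (W q *v v))" by (rule inner_matrix_transpose[symmetric])
    moreover have "(norm (e - \<alpha> *\<^sub>R y))\<^sup>2 = (norm e)\<^sup>2 - 2 * \<alpha> * (e \<bullet> y) + \<alpha>\<^sup>2 * (norm y)\<^sup>2"
      for y :: "real ^ 'm"
      unfolding power2_norm_eq_inner
      by (simp add: power2_eq_square[of \<alpha>] inner_diff_left inner_diff_right inner_commute[of y e] algebra_simps)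
    ultimately show ?thesis by simp
  qed
  note l = bounded_linear_matrix_form[of "transpose A *v e" v] and b = bounded_linear_matrix_form[of v v]
  have il: "integrable M (\<lambda>q. ?l (W q))" by (rule integrable_bounded_linear[OF l W])
  have ib: "integrable M (\<lambda>q. ?b (?G q))" by (rule integrable_bounded_linear[OF b G])
  show "integrable M (\<lambda>q. (norm (e - \<alpha> *\<^sub>R (A *v (W q *v v))))\<^sup>2)"
    unfolding expand using il ib by simp
  have "expectation (\<lambda>q. (norm (e - \<alpha> *\<^sub>R (A *v (W q *v v))))\<^sup>2)
      = (norm e)\<^sup>2 - 2 * \<alpha> * ?l (expectation W) + \<alpha>\<^sup>2 * ?b (expectation ?G)"
    unfolding expand
    using il ib integral_bounded_linear[OF l W] integral_bounded_linear[OF b G]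
    by (simp add: prob_space)
  also have "?l (expectation W) = c * ((transpose A *v e) \<bullet> (transpose A *v v))"
    by (simp add: EW scaleR_matrix_vector_assoc[symmetric])
  also have "\<alpha>\<^sup>2 * ?b (expectation ?G) \<le> \<alpha>\<^sup>2 * (spectral_norm (expectation ?G) * (norm v)\<^sup>2)"
    by (intro mult_left_mono inner_le_spectral_norm) auto
  finally show "expectation (\<lambda>q. (norm (e - \<alpha> *\<^sub>R (A *v (W q *v v))))\<^sup>2)
       \<le> (norm e)\<^sup>2 - 2 * \<alpha> * c * ((transpose A *v e) \<bullet> (transpose A *v v))
         + \<alpha>\<^sup>2 * spectral_norm (expectation ?G) * (norm v)\<^sup>2"
    by (simp add: algebra_simps)
qed

section \<open>Unrolling the recurrence; the iterates as functions of the draws\<close>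

lemma affine_recurrence_le:
  fixes a :: "nat \<Rightarrow> real"
  assumes "0 \<le> \<eta>" "\<eta> \<noteq> 1" and step: "\<And>k. a (Suc k) \<le> \<eta> * a k + c"
  shows "a k \<le> \<eta> ^ k * a 0 + c * (1 - \<eta> ^ k) / (1 - \<eta>)"
proof (induction k)
  case (Suc k)
  have "a (Suc k) \<le> \<eta> * (\<eta> ^ k * a 0 + c * (1 - \<eta> ^ k) / (1 - \<eta>)) + c"
    using step[of k] mult_left_mono[OF Suc \<open>0 \<le> \<eta>\<close>] by linarith
  also have "\<dots> = \<eta> ^ Suc k * a 0 + c * (1 - \<eta> ^ Suc k) / (1 - \<eta>)"
    using \<open>\<eta> \<noteq> 1\<close> by (simp add: field_simps)
  finally show ?case .
qed simp

text \<open>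
  The iterate as a function of the sequence of draws; through it, independence of the draws makes
  the \<open>k\<close>-th iterate independent of the \<open>k\<close>-th draw.
\<close>

primrec pfr_iterate ::
  "real ^ 'n ^ 'm \<Rightarrow> real ^ 'm \<Rightarrow> real \<Rightarrow> real ^ 'n \<Rightarrow> ('q \<Rightarrow> real ^ 'm ^ 'n) \<Rightarrow> nat \<Rightarrow> (nat \<Rightarrow> 'q)
    \<Rightarrow> real ^ 'n" where
  "pfr_iterate A b \<alpha> x\<^sub>0 W 0 \<omega> = x\<^sub>0"
| "pfr_iterate A b \<alpha> x\<^sub>0 W (Suc k) \<omega> = pfr_iterate A b \<alpha> x\<^sub>0 W k \<omega>
     - \<alpha> *\<^sub>R (W (\<omega> k) *v (A *v pfr_iterate A b \<alpha> x\<^sub>0 W k \<omega> - b))"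

lemma borel_measurable_matrix_vector_mult:
  fixes f :: "'a \<Rightarrow> real ^ 'n ^ 'm"
  assumes "f \<in> borel_measurable M" "g \<in> borel_measurable M"
  shows "(\<lambda>x. f x *v g x) \<in> borel_measurable M"
  by (rule borel_measurable_continuous_Pair[OF assms])
    (unfold matrix_vector_mult_def, intro continuous_intros)

text \<open>The product space over \<open>{..<n}\<close> stays fixed while k grows, so the induction
  compares iterates on one space; the k-th iterate reads only coordinates below k.\<close>

lemma pfr_iterate_measurable:
  fixes W :: "'q \<Rightarrow> real ^ 'm ^ 'n"
  assumes "W \<in> borel_measurable D" and "k \<le> n"
  shows "pfr_iterate A b \<alpha> x\<^sub>0 W k \<in> borel_measurable (\<Pi>\<^sub>M j\<in>{..<n}. D)"
  using \<open>k \<le> n\<close>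
proof (induction k)
  case 0
  have "pfr_iterate A b \<alpha> x\<^sub>0 W 0 = (\<lambda>_. x\<^sub>0)" by (rule ext) simp
  then show ?case by simp
next
  case (Suc k)
  let ?x = "pfr_iterate A b \<alpha> x\<^sub>0 W k"
  have x: "?x \<in> borel_measurable (\<Pi>\<^sub>M j\<in>{..<n}. D)" using Suc by simp
  have W: "(\<lambda>\<omega>. W (\<omega> k)) \<in> borel_measurable (\<Pi>\<^sub>M j\<in>{..<n}. D)"
    using Suc.prems by (intro measurable_compose[OF _ assms(1)] measurable_component_singleton) simp
  have "pfr_iterate A b \<alpha> x\<^sub>0 W (Suc k)
      = (\<lambda>\<omega>. ?x \<omega> - \<alpha> *\<^sub>R (W (\<omega> k) *v (A *v ?x \<omega> - b)))" by (rule ext) simp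
  moreover have "\<dots> \<in> borel_measurable (\<Pi>\<^sub>M j\<in>{..<n}. D)"
    by (intro borel_measurable_diff borel_measurable_scaleR borel_measurable_const x W
        borel_measurable_matrix_vector_mult)
  ultimately show ?case by simp
qed

text \<open>Allows the full sequence of draws to be replaced by its restriction to the past.\<close>

lemma pfr_iterate_cong:
  "(\<And>j. j < k \<Longrightarrow> \<omega> j = \<omega>' j) \<Longrightarrow> pfr_iterate A b \<alpha> x\<^sub>0 W k \<omega> = pfr_iterate A b \<alpha> x\<^sub>0 W k \<omega>'"
  by (induction k) auto

section \<open>The mean-square residual bound\<close>

theorem theorem3p1:
  fixes A :: "real ^ 'n ^ 'm"
    and b :: "real ^ 'm"
    and D :: "((real ^ 'm) list \<times> (real ^ 'm) list \<times> (real ^ 'n) list \<times> (real ^ 'n) list) measure"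
    and M :: "'w measure"
    and Q :: "nat \<Rightarrow> 'w \<Rightarrow> (real ^ 'm) list \<times> (real ^ 'm) list \<times> (real ^ 'n) list \<times> (real ^ 'n) list"
    and x\<^sub>0 x_LS :: "real ^ 'n"
    and x :: "nat \<Rightarrow> 'w \<Rightarrow> real ^ 'n"
    and r :: "nat \<Rightarrow> 'w \<Rightarrow> real ^ 'm"
    and r\<^sub>0 r_star :: "real ^ 'm"
    and \<alpha> \<beta> \<eta> :: real
  assumes "A \<noteq> 0"
    and "prob_space D" and "sets D = sets quadruple_algebra"
    and "integrable D (\<lambda>(S\<^sub>1, S\<^sub>2, T\<^sub>1, T\<^sub>2).
           mult_transpose T\<^sub>1 T\<^sub>2 ** transpose A ** mult_transpose S\<^sub>1 S\<^sub>2)"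
    and "integrable D (\<lambda>(S\<^sub>1, S\<^sub>2, T\<^sub>1, T\<^sub>2).
           mult_transpose S\<^sub>2 S\<^sub>1 ** A ** mult_transpose T\<^sub>2 T\<^sub>1 ** transpose A **
           A ** mult_transpose T\<^sub>1 T\<^sub>2 ** transpose A ** mult_transpose S\<^sub>1 S\<^sub>2)"
    and "(LINT (S\<^sub>1, S\<^sub>2, T\<^sub>1, T\<^sub>2)|D.
           mult_transpose T\<^sub>1 T\<^sub>2 ** transpose A ** mult_transpose S\<^sub>1 S\<^sub>2)
         = (1 / (frobenius_norm A)\<^sup>2) *\<^sub>R transpose A"
    and "prob_space M"
    and "prob_space.indep_vars M (\<lambda>_. D) Q UNIV"
    and "\<And>k. distr M D (Q k) = D"
    and "\<And>\<omega>. \<omega> \<in> space M \<Longrightarrow> x 0 \<omega> = x\<^sub>0"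
    and "\<And>k \<omega> S\<^sub>1 S\<^sub>2 T\<^sub>1 T\<^sub>2. \<omega> \<in> space M \<Longrightarrow> Q k \<omega> = (S\<^sub>1, S\<^sub>2, T\<^sub>1, T\<^sub>2) \<Longrightarrow>
           x (Suc k) \<omega> = x k \<omega> -
             \<alpha> *\<^sub>R ((mult_transpose T\<^sub>1 T\<^sub>2 ** transpose A ** mult_transpose S\<^sub>1 S\<^sub>2) *v (A *v x k \<omega> - b))"
    and "x_LS = pseudoinverse A *v b"
    and "r_star = A *v x_LS - b"
    and "r\<^sub>0 = A *v x\<^sub>0 - b"
    and "\<And>k \<omega>. r k \<omega> = A *v x k \<omega> - b"
    and "\<And>k. integrable M (\<lambda>\<omega>. (norm (r k \<omega> - r_star))\<^sup>2)"
    and "\<beta> = spectral_norm (LINT (S\<^sub>1, S\<^sub>2, T\<^sub>1, T\<^sub>2)|D.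
           mult_transpose S\<^sub>2 S\<^sub>1 ** A ** mult_transpose T\<^sub>2 T\<^sub>1 ** transpose A **
           A ** mult_transpose T\<^sub>1 T\<^sub>2 ** transpose A ** mult_transpose S\<^sub>1 S\<^sub>2)"
    and "\<eta> = 1 - 2 * \<alpha> * ((sigma_min A)\<^sup>2 / (frobenius_norm A)\<^sup>2) + 2 * \<alpha>\<^sup>2 * \<beta>"
    and "0 < \<alpha>" and "\<alpha> < (sigma_min A)\<^sup>2 / (\<beta> * (frobenius_norm A)\<^sup>2)"
  shows "\<forall>k. prob_space.expectation M (\<lambda>\<omega>. (norm (r k \<omega> - r_star))\<^sup>2)
           \<le> \<eta> ^ k * (norm (r\<^sub>0 - r_star))\<^sup>2
             + 2 * \<alpha>\<^sup>2 * \<beta> * (1 - \<eta> ^ k) * (norm r_star)\<^sup>2 / (1 - \<eta>)"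
proof -
  define \<sigma> F where "\<sigma> = sigma_min A" and "F = frobenius_norm A"
  define W where "W = (\<lambda>(S\<^sub>1, S\<^sub>2, T\<^sub>1, T\<^sub>2).
    mult_transpose T\<^sub>1 T\<^sub>2 ** transpose A ** mult_transpose S\<^sub>1 S\<^sub>2)"
  define H where "H = (\<lambda>(S\<^sub>1, S\<^sub>2, T\<^sub>1, T\<^sub>2).
    mult_transpose S\<^sub>2 S\<^sub>1 ** A ** mult_transpose T\<^sub>2 T\<^sub>1 ** transpose A **
    A ** mult_transpose T\<^sub>1 T\<^sub>2 ** transpose A ** mult_transpose S\<^sub>1 S\<^sub>2)"
  interpret D: prob_space D by fact
  interpret M: prob_space M by fact
  have W: "integrable D W" and EW: "D.expectation W = (1 / F\<^sup>2) *\<^sub>R transpose A"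
    using assms(4,6) by (simp_all only: W_def F_def)
  have H: "integrable D H" and \<beta>: "\<beta> = spectral_norm (D.expectation H)"
    using assms(5,17) by (simp_all only: H_def)
  \<comment> \<open>Transposition reverses the factors of W. The matching column counts it requires
    are built into the space of \<open>quadruple_algebra\<close>, hence the restriction to
    \<open>space D\<close>.\<close>
  have H_eq: "H q = transpose (W q) ** transpose A ** A ** W q" if "q \<in> space D" for q
  proof -
    obtain S\<^sub>1 S\<^sub>2 T\<^sub>1 T\<^sub>2 where q: "q = (S\<^sub>1, S\<^sub>2, T\<^sub>1, T\<^sub>2)" by (cases q)
    have "q \<in> space quadruple_algebra" using that sets_eq_imp_space_eq[OF assms(3)] by simp
    then have "length S\<^sub>1 = length S\<^sub>2" "length T\<^sub>1 = length T\<^sub>2"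
      by (auto simp: quadruple_algebra_def space_restrict_space q)
    then show ?thesis
      by (simp add: H_def W_def q matrix_transpose_mul transpose_mult_transpose matrix_mul_assoc)
  qed
  have G: "integrable D (\<lambda>q. transpose (W q) ** transpose A ** A ** W q)"
    by (rule iffD1[OF Bochner_Integration.integrable_cong H]) (simp_all add: H_eq)
  have \<beta>_eq: "spectral_norm (D.expectation (\<lambda>q. transpose (W q) ** transpose A ** A ** W q)) = \<beta>"
    unfolding \<beta> by (intro arg_cong[of _ _ spectral_norm] Bochner_Integration.integral_cong) (simp_all add: H_eq)
  have "F > 0" using assms(1) by (simp add: F_def frobenius_norm_eq_norm)
  have "\<beta> \<ge> 0" unfolding \<beta> by (rule spectral_norm_nonneg)
  \<comment> \<open>If \<open>\<beta> = 0\<close>, the upper bound on \<open>\<alpha>\<close> is a division by zero, hence \<open>0\<close>.\<close>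
  have "\<beta> \<noteq> 0" using assms(19,20) by auto
  with \<open>\<beta> \<ge> 0\<close> have "\<beta> > 0" by simp
  have \<eta>: "\<eta> = 1 - 2 * \<alpha> * (\<sigma>\<^sup>2 / F\<^sup>2) + 2 * \<alpha>\<^sup>2 * \<beta>"
    using assms(18) by (simp only: \<sigma>_def F_def)
  have "\<alpha> * \<beta> < \<sigma>\<^sup>2 / F\<^sup>2"
    using assms(20) \<open>F > 0\<close> \<open>\<beta> > 0\<close> by (simp add: \<sigma>_def[symmetric] F_def[symmetric] field_simps)
  then have "\<alpha> * (\<alpha> * \<beta>) < \<alpha> * (\<sigma>\<^sup>2 / F\<^sup>2)" using \<open>0 < \<alpha>\<close> by (rule mult_strict_left_mono)
  then have "\<eta> < 1" by (simp add: \<eta> power2_eq_square)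
  have residual: "transpose A *v r_star = 0"
    using transpose_mult_residual[of A b] by (simp add: assms(12,13))

  \<comment> \<open>Here e is an error in the range of A and v the residual driving the step. Asking
    only for equal images under A^T covers both v = e + r_star, for the iteration, and v = e, for
    the sign of \<eta>.\<close>
  have step: "D.expectation (\<lambda>q. (norm (e - \<alpha> *\<^sub>R (A *v (W q *v v))))\<^sup>2)
      \<le> (1 - 2 * \<alpha> * (\<sigma>\<^sup>2 / F\<^sup>2)) * (norm e)\<^sup>2 + \<alpha>\<^sup>2 * \<beta> * (norm v)\<^sup>2"
    if e: "e = A *v u" and v: "transpose A *v v = transpose A *v e" for e u v
  proof -
    have "2 * \<alpha> * (1 / F\<^sup>2) * (\<sigma>\<^sup>2 * (norm e)\<^sup>2)
        \<le> 2 * \<alpha> * (1 / F\<^sup>2) * ((transpose A *v e) \<bullet> (transpose A *v v))"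
      using sigma_min_le[OF assms(1), of u] \<open>0 < \<alpha>\<close> unfolding v power2_norm_eq_inner[symmetric]
      by (intro mult_left_mono) (auto simp: e \<sigma>_def)
    then show ?thesis
      using D.expectation_norm_step_sq_le[OF W G EW, of e \<alpha> v] by (simp add: \<beta>_eq algebra_simps)
  qed

  \<comment> \<open>An expected squared norm after one step with \<open>v = e\<close> is nonnegative.\<close>
  have "0 \<le> \<eta>"
  proof -
    obtain u where u: "A *v u \<noteq> 0" using assms(1) by (metis matrix_eq matrix_vector_mult_0)
    have "0 \<le> D.expectation (\<lambda>q. (norm (A *v u - \<alpha> *\<^sub>R (A *v (W q *v (A *v u)))))\<^sup>2)"
      by (rule Bochner_Integration.integral_nonneg) simp
    also have "\<dots> \<le> (1 - 2 * \<alpha> * (\<sigma>\<^sup>2 / F\<^sup>2) + \<alpha>\<^sup>2 * \<beta>) * (norm (A *v u))\<^sup>2"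
      using step[of "A *v u" u "A *v u"] by (simp add: algebra_simps)
    \<comment> \<open>The term \<alpha>^2 \<beta> occurs once here and twice in \<eta>, so \<eta> is
      at least this large.\<close>
    finally have "0 \<le> 1 - 2 * \<alpha> * (\<sigma>\<^sup>2 / F\<^sup>2) + \<alpha>\<^sup>2 * \<beta>"
      using u by (simp add: zero_le_mult_iff)
    then show ?thesis unfolding \<eta> using \<open>\<beta> > 0\<close> zero_le_power2[of \<alpha>] mult_nonneg_nonneg[of "\<alpha>\<^sup>2" \<beta>]
      by linarith
  qed

  define c where "c = 2 * \<alpha>\<^sup>2 * \<beta> * (norm r_star)\<^sup>2"
  define er where "er = (\<lambda>z. A *v z - b - r_star)"
  define next_er where "next_er = (\<lambda>z q. er z - \<alpha> *\<^sub>R (A *v (W q *v (A *v z - b))))"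
  have "c \<ge> 0" using \<open>\<beta> > 0\<close> by (simp add: c_def)
  have next_le: "D.expectation (\<lambda>q. (norm (next_er z q))\<^sup>2) \<le> \<eta> * (norm (er z))\<^sup>2 + c" for z
  proof -
    have v: "A *v z - b = er z + r_star" by (simp add: er_def)
    have e: "er z = A *v (z - x_LS)"
      by (simp add: er_def assms(13) matrix_vector_mult_diff_distrib)
    have "transpose A *v (A *v z - b) = transpose A *v er z"
      unfolding v by (simp add: matrix_vector_right_distrib residual)
    from step[OF e this]
    have "D.expectation (\<lambda>q. (norm (next_er z q))\<^sup>2)
        \<le> (1 - 2 * \<alpha> * (\<sigma>\<^sup>2 / F\<^sup>2)) * (norm (er z))\<^sup>2 + \<alpha>\<^sup>2 * \<beta> * (norm (er z + r_star))\<^sup>2"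
      by (simp only: next_er_def v[symmetric])
    also have "\<alpha>\<^sup>2 * \<beta> * (norm (er z + r_star))\<^sup>2
        \<le> \<alpha>\<^sup>2 * \<beta> * (2 * (norm (er z))\<^sup>2 + 2 * (norm r_star)\<^sup>2)"
    \<comment> \<open>The parallelogram law separates the error from r_star; this is the source of
      the factor 2 in \<eta> and in the additive constant.\<close>
    proof (rule mult_left_mono)
      have "(norm (er z + r_star))\<^sup>2 + (norm (er z - r_star))\<^sup>2
          = 2 * (norm (er z))\<^sup>2 + 2 * (norm r_star)\<^sup>2"
        unfolding power2_norm_eq_inner by (simp add: inner_add_left inner_add_right inner_diff_left inner_diff_right)
      then show "(norm (er z + r_star))\<^sup>2 \<le> 2 * (norm (er z))\<^sup>2 + 2 * (norm r_star)\<^sup>2"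
        using zero_le_power2[of "norm (er z - r_star)"] by linarith
    qed (use \<open>\<beta> > 0\<close> in simp)
    finally show ?thesis by (simp add: \<eta> c_def algebra_simps)
  qed

  have x_next: "x (Suc k) \<omega> = x k \<omega> - \<alpha> *\<^sub>R (W (Q k \<omega>) *v (A *v x k \<omega> - b))"
    if "\<omega> \<in> space M" for k \<omega>
    using assms(11)[OF that] by (cases "Q k \<omega>") (simp add: W_def)
  have er_next: "r (Suc k) \<omega> - r_star = next_er (x k \<omega>) (Q k \<omega>)" if "\<omega> \<in> space M" for k \<omega>
    by (simp add: assms(15) x_next[OF that] next_er_def er_def matrix_vector_mult_diff_distrib
        matrix_vector_mult_scaleR)
  define P where "P = pfr_iterate A b \<alpha> x\<^sub>0 W"
  have x_eq: "x k \<omega> = P k (\<lambda>j. Q j \<omega>)" if "\<omega> \<in> space M" for k \<omega>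
    using that by (induction k) (simp_all add: P_def assms(10) x_next)
  have WM: "W \<in> borel_measurable D" using W by (rule borel_measurable_integrable)

  define a where "a = (\<lambda>k. M.expectation (\<lambda>\<omega>. (norm (r k \<omega> - r_star))\<^sup>2))"
  have "a (Suc k) \<le> \<eta> * a k + c" for k
  proof -
    \<comment> \<open>The k-th iterate depends on draws with index below k, its update on draw k.
      These index sets are disjoint, so the two blocks of draws are independent.\<close>
    let ?past = "\<lambda>\<omega>. restrict (\<lambda>i. Q i \<omega>) {..<k}" and ?now = "\<lambda>\<omega>. restrict (\<lambda>i. Q i \<omega>) {k}"
    let ?S = "\<Pi>\<^sub>M j\<in>{..<k}. D" and ?T = "\<Pi>\<^sub>M j\<in>{k}. D"
    have ind: "M.indep_var ?S ?past ?T ?now" by (rule M.indep_var_restrict[OF assms(8)]) auto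
    have x_past: "x k \<omega> = P k (?past \<omega>)" if "\<omega> \<in> space M" for \<omega>
      unfolding x_eq[OF that] P_def by (rule pfr_iterate_cong) simp
    have Pk: "P k \<in> borel_measurable ?S"
      unfolding P_def by (rule pfr_iterate_measurable[OF WM]) simp
    have Qk: "Q k \<in> measurable M D"
      using assms(8) by (auto simp: M.indep_vars_def)
    have er: "(\<lambda>\<omega>. er (f \<omega>)) \<in> borel_measurable N"
      if "f \<in> borel_measurable N" for f and N :: "'z measure"
      unfolding er_def using that
      by (intro borel_measurable_diff borel_measurable_const borel_measurable_matrix_vector_mult)
    have next_er: "(\<lambda>\<omega>. next_er (f \<omega>) (q \<omega>)) \<in> borel_measurable N"
      if "f \<in> borel_measurable N" "q \<in> measurable N D" for f q and N :: "'z measure"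
      unfolding next_er_def using that
      by (intro er borel_measurable_diff borel_measurable_scaleR borel_measurable_const
          borel_measurable_matrix_vector_mult measurable_compose[OF _ WM])
    have "(\<integral>\<^sup>+ \<omega>. ennreal ((norm (next_er (P k (?past \<omega>)) (?now \<omega> k)))\<^sup>2) \<partial>M)
        \<le> (\<integral>\<^sup>+ \<omega>. ennreal (\<eta> * (norm (er (P k (?past \<omega>))))\<^sup>2 + c) \<partial>M)"
    proof (rule M.indep_var_nn_integral_le[OF ind])
      have "(\<lambda>p. next_er (P k (fst p)) (snd p k)) \<in> borel_measurable (?S \<Otimes>\<^sub>M ?T)"
        by (intro next_er measurable_compose[OF measurable_fst Pk]
            measurable_compose[OF measurable_snd] measurable_component_singleton) simp
      then show "(\<lambda>(f, q). ennreal ((norm (next_er (P k f) (q k)))\<^sup>2)) \<in> borel_measurable (?S \<Otimes>\<^sub>M ?T)"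
        unfolding case_prod_beta by measurable
      have "(\<lambda>f. er (P k f)) \<in> borel_measurable ?S" by (rule er[OF Pk])
      then show "(\<lambda>f. ennreal (\<eta> * (norm (er (P k f)))\<^sup>2 + c)) \<in> borel_measurable ?S"
        by measurable
      \<comment> \<open>With the past frozen at \<open>f\<close> the iterate is constant, and draw k
        has law \<open>D\<close>; the inner integral is thus the one-step expectation bounded by
        \<open>next_le\<close>.\<close>
      fix f
      let ?z = "P k f"
      have "(\<lambda>q. next_er ?z q) \<in> borel_measurable D" by (intro next_er) auto
      then have "(\<integral>\<^sup>+ \<omega>. ennreal ((norm (next_er ?z (?now \<omega> k)))\<^sup>2) \<partial>M)
          = (\<integral>\<^sup>+ q. ennreal ((norm (next_er ?z q))\<^sup>2) \<partial>distr M D (Q k))"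
        by (subst nn_integral_distr[OF Qk]) simp_all
      also have "\<dots> = (\<integral>\<^sup>+ q. ennreal ((norm (next_er ?z q))\<^sup>2) \<partial>D)" by (simp only: assms(9))
      also have "\<dots> = ennreal (D.expectation (\<lambda>q. (norm (next_er ?z q))\<^sup>2))"
        unfolding next_er_def
        by (intro nn_integral_eq_integral D.integrable_norm_step_sq[OF W G EW]) simp
      also have "\<dots> \<le> ennreal (\<eta> * (norm (er ?z))\<^sup>2 + c)" by (intro ennreal_leI next_le)
      finally show "(\<integral>\<^sup>+ \<omega>. ennreal ((norm (next_er ?z (?now \<omega> k)))\<^sup>2) \<partial>M)
          \<le> ennreal (\<eta> * (norm (er ?z))\<^sup>2 + c)" .
    qed
    also have "(\<integral>\<^sup>+ \<omega>. ennreal ((norm (next_er (P k (?past \<omega>)) (?now \<omega> k)))\<^sup>2) \<partial>M)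
        = (\<integral>\<^sup>+ \<omega>. ennreal ((norm (r (Suc k) \<omega> - r_star))\<^sup>2) \<partial>M)"
      by (intro nn_integral_cong) (simp add: x_past[symmetric] er_next)
    also have "\<dots> = ennreal (a (Suc k))"
      unfolding a_def by (intro nn_integral_eq_integral assms(16)) simp
    also have "(\<integral>\<^sup>+ \<omega>. ennreal (\<eta> * (norm (er (P k (?past \<omega>))))\<^sup>2 + c) \<partial>M)
        = (\<integral>\<^sup>+ \<omega>. ennreal (\<eta> * (norm (r k \<omega> - r_star))\<^sup>2 + c) \<partial>M)"
      by (intro nn_integral_cong) (simp add: x_past[symmetric] er_def assms(15))
    also have "\<dots> = ennreal (M.expectation (\<lambda>\<omega>. \<eta> * (norm (r k \<omega> - r_star))\<^sup>2 + c))"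
      using \<open>0 \<le> \<eta>\<close> \<open>0 \<le> c\<close> assms(16)[of k] by (intro nn_integral_eq_integral) auto
    also have "M.expectation (\<lambda>\<omega>. \<eta> * (norm (r k \<omega> - r_star))\<^sup>2 + c) = \<eta> * a k + c"
      using assms(16)[of k] by (simp add: a_def M.prob_space)
    finally have "ennreal (a (Suc k)) \<le> ennreal (\<eta> * a k + c)" .
    \<comment> \<open>\<open>ennreal\<close> truncates negative reals to 0, so returning to a real
      inequality uses that the right-hand side is nonnegative.\<close>
    moreover have "0 \<le> \<eta> * a k + c"
      using \<open>0 \<le> \<eta>\<close> \<open>0 \<le> c\<close> by (simp add: a_def)
    ultimately show ?thesis by (simp add: ennreal_le_iff)
  qed
  then have "a k \<le> \<eta> ^ k * a 0 + c * (1 - \<eta> ^ k) / (1 - \<eta>)" for k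
    using \<open>0 \<le> \<eta>\<close> \<open>\<eta> < 1\<close> by (intro affine_recurrence_le) auto
  moreover have "a 0 = (norm (r\<^sub>0 - r_star))\<^sup>2"
  proof -
    have "a 0 = M.expectation (\<lambda>_. (norm (r\<^sub>0 - r_star))\<^sup>2)"
      unfolding a_def by (intro Bochner_Integration.integral_cong) (simp_all add: assms(10,14,15))
    then show ?thesis by (simp add: M.prob_space)
  qed
  ultimately show ?thesis by (simp add: a_def c_def ac_simps)
qed

end
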